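(* Let $d\ge 2$ be an integer. If a finite simple graph $G$ is the intersection graph of a finite family of homothetic closed regular $(d-1)$-simplices in $\mathbb{R}^{d-1}$, then there exists a nonnegative integer $k$ such that the disjoint union of $G$ and $k$ new isolated vertices is (isomorphic to) the competition graph of a $d$-partial order.
   Context: For $\mathbf{x},\mathbf{y}\in\mathbb{R}^d$, write $\mathbf{x}\prec\mathbf{y}$ if $x_i<y_i$ for every $i$. For a finite set $S\subseteq\mathbb{R}^d$, $D_S$ is the digraph with vertex set $S$ and an arc $(\mathbf{x},\mathbf{v})$ whenever $\mathbf{v}\prec\mathbf{x}$. A digraph is a $d$-partial order if it is isomorphic to $D_S$ for some finite $S\subseteq\mathbb{R}^d$. The competition graph of a digraph $D$ has vertex set $V(D)$ and an edge between distinct $x,y$ iff some vertex $z$ has arcs $(x,z),(y,z)$ in $D$. Figures are homothetic if one is the image of the other under $\mathbf{x}\mapsto\lambda\mathbf{x}+\mathbf{b}$ with $\lambda>0$. The intersection graph of a family has one vertex per member, two adjacent iff the members intersect. *)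

theory Defs
  imports
    "HOL-Analysis.Analysis"
    "Graph_Theory.Digraph_Isomorphism"
    "Graph_Theory.Pair_Digraph"
begin

text \<open>
  A digraph is a \<^typ>\<open>'a pair_pre_digraph\<close>. A finite simple graph is a \<^const>\<open>pair_graph\<close>: a finite,
  loop-free digraph without parallel arcs whose arc set is symmetric, an edge \<open>xy\<close> being the two
  arcs \<open>(x, y)\<close> and \<open>(y, x)\<close>.
\<close>

abbreviation isomorphic :: "'a pair_pre_digraph \<Rightarrow> 'b pair_pre_digraph \<Rightarrow> bool" where
  "isomorphic G H \<equiv> digraph_iso (with_proj G) (with_proj H)"

definition disjoint_isolated :: "'a pair_pre_digraph \<Rightarrow> nat \<Rightarrow> ('a + nat) pair_pre_digraph" where
  "disjoint_isolated G k =
     \<lparr> pverts = Inl ` pverts G \<union> Inr ` {..<k},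
       parcs = {(Inl x, Inl y) | x y. (x, y) \<in> parcs G} \<rparr>"

definition intersection_graph :: "'i set \<Rightarrow> ('i \<Rightarrow> 'a set) \<Rightarrow> 'i pair_pre_digraph" where
  "intersection_graph I T =
     \<lparr> pverts = I,
       parcs = {(i, j). i \<in> I \<and> j \<in> I \<and> i \<noteq> j \<and> T i \<inter> T j \<noteq> {}} \<rparr>"

definition competition_graph :: "'a pair_pre_digraph \<Rightarrow> 'a pair_pre_digraph" where
  "competition_graph D =
     \<lparr> pverts = pverts D,
       parcs = {(x, y). x \<in> pverts D \<and> y \<in> pverts D \<and> x \<noteq> y \<and>
                  (\<exists>z \<in> pverts D. (x, z) \<in> parcs D \<and> (y, z) \<in> parcs D)} \<rparr>"

text \<open>
  This is strictness in every coordinate; the order \<open><\<close> that the library puts on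
  \<^typ>\<open>real ^ 'n\<close> only asks for \<open>x \<le> y\<close> and \<open>x \<noteq> y\<close>.
\<close>

definition strictly_below :: "real ^ 'n \<Rightarrow> real ^ 'n \<Rightarrow> bool" where
  "strictly_below x y \<longleftrightarrow> (\<forall>i. x $ i < y $ i)"

definition order_digraph :: "(real ^ 'n) set \<Rightarrow> (real ^ 'n) pair_pre_digraph" where
  "order_digraph S = \<lparr> pverts = S, parcs = {(x, v). x \<in> S \<and> v \<in> S \<and> strictly_below v x} \<rparr>"

text \<open>The dimension \<open>d\<close> of a \<open>d\<close>-partial order is \<open>CARD('n)\<close>.\<close>

definition partial_order_digraph :: "'n::finite itself \<Rightarrow> 'a pair_pre_digraph \<Rightarrow> bool" where
  "partial_order_digraph _ D \<longleftrightarrow>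
     (\<exists>S :: (real ^ 'n) set. finite S \<and> isomorphic D (order_digraph S))"

definition homothetic :: "'a::real_vector set \<Rightarrow> 'a set \<Rightarrow> bool" where
  "homothetic A B \<longleftrightarrow> (\<exists>c b. c > 0 \<and> B = (\<lambda>x. c *\<^sub>R x + b) ` A)"

text \<open>
  The library's \<^const>\<open>simplex\<close> is the (closed) convex hull of affinely independent points, which are
  its extreme points; regular means that all edges have the same length.
\<close>

definition regular_simplex :: "nat \<Rightarrow> 'a::euclidean_space set \<Rightarrow> bool" where
  "regular_simplex n A \<longleftrightarrow>
     int n simplex A \<and>
     (\<exists>l. \<forall>x y. x extreme_point_of A \<longrightarrow> y extreme_point_of A \<longrightarrow> x \<noteq> y \<longrightarrow> dist x y = l)"

end

(*
  In barycentric coordinates with respect to one of the simplices, R^(d-1) is the hyperplane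
  {w. sum w = 1} of R^d and every simplex of the family is the part of it lying above a corner
  p i. So T i and T j meet iff the sum of the coordinatewise maximum of p i and p j is at most 1.
  After reflection to q i = - p i, represent i by the point v i obtained by raising q i slightly
  along the diagonal, and give every intersecting pair a common prey below q i and q j in the
  hyperplane {z. sum z = -1}. The points v i lie above this hyperplane, so the prey have
  no out-neighbours and are isolated, and any point below both v i and v j, prey or not, forces the
  sum of the minimum of v i and v j to be at least -1, hence, if the shift is small, T i and T j
  to meet.
*)

theory Submission
  imports Defs
begin

section \<open>Digraph isomorphisms as vertex bijections\<close>

lemma wf_digraph_with_projI:
  assumes "parcs G \<subseteq> pverts G \<times> pverts G"
  shows "wf_digraph (with_proj G)"
  using assms by (auto intro!: wf_digraph.intro)

text \<open>Arcs are vertex pairs here, so a vertex bijection \<open>f\<close> that preserves and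
  reflects arcs determines all other components of a library isomorphism: the arc map has to be
  \<open>map_prod f f\<close>, with projections as tail and head.\<close>

lemma isomorphicI:
  assumes "parcs G \<subseteq> pverts G \<times> pverts G" and "parcs H \<subseteq> pverts H \<times> pverts H"
    and bij: "bij_betw f (pverts G) (pverts H)"
    and arcs: "\<And>x y. x \<in> pverts G \<Longrightarrow> y \<in> pverts G \<Longrightarrow> (x, y) \<in> parcs G \<longleftrightarrow> (f x, f y) \<in> parcs H"
  shows "isomorphic G H"
proof -
  let ?h = "\<lparr>iso_verts = f, iso_arcs = map_prod f f, iso_head = snd, iso_tail = fst\<rparr>"
  have inj: "inj_on f (pverts G)" and img: "pverts H = f ` pverts G"
    using bij by (auto simp: bij_betw_def)
  have "inj_on (map_prod f f) (parcs G)"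
    using map_prod_inj_on[OF inj inj] assms(1) inj_on_subset by blast
  then have "pre_digraph.digraph_isomorphism (with_proj G) ?h"
    using wf_digraph_with_projI[OF assms(1)] inj
    by (simp add: pre_digraph.digraph_isomorphism_def)
  moreover have "parcs H = map_prod f f ` parcs G"
  proof (intro equalityI subrelI)
    fix a b assume ab: "(a, b) \<in> parcs H"
    then obtain x y where "x \<in> pverts G" "y \<in> pverts G" "a = f x" "b = f y"
      using assms(2) img by blast
    with ab arcs show "(a, b) \<in> map_prod f f ` parcs G" by force
  qed (use assms(1) arcs in auto)
  then have "with_proj H = app_iso ?h (with_proj G)"
    by (simp add: app_iso_def with_proj_def img)
  ultimately show ?thesis
    unfolding digraph_iso_def by blast
qed

text \<open>\<open>with_proj\<close> makes tail and head the projections in both digraphs, so the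
  arc map of an isomorphism must act as its vertex map on both components. This lets later arguments
  speak of vertices only.\<close>

lemma isomorphicE:
  assumes "isomorphic G H" and sub: "parcs G \<subseteq> pverts G \<times> pverts G"
  obtains f where "bij_betw f (pverts G) (pverts H)"
    and "\<And>x y. x \<in> pverts G \<Longrightarrow> y \<in> pverts G \<Longrightarrow> (x, y) \<in> parcs G \<longleftrightarrow> (f x, f y) \<in> parcs H"
proof -
  obtain h where h: "pre_digraph.digraph_isomorphism (with_proj G) h"
    and eq: "with_proj H = app_iso h (with_proj G)"
    using assms(1) unfolding digraph_iso_def by blast
  let ?f = "iso_verts h"
  have img: "pverts H = ?f ` pverts G" and arcsH: "parcs H = iso_arcs h ` parcs G"
    and tl: "iso_tail h = fst" and hd: "iso_head h = snd"
    using eq by (auto simp: with_proj_def app_iso_def)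
  have inj: "inj_on ?f (pverts G)"
    using h by (simp add: pre_digraph.digraph_isomorphism_def)
  have arc: "iso_arcs h (x, y) = (?f x, ?f y)" if "(x, y) \<in> parcs G" for x y
    using h that by (auto simp: pre_digraph.digraph_isomorphism_def tl hd prod_eq_iff)
  show thesis
  proof
    show "bij_betw ?f (pverts G) (pverts H)"
      using inj img by (simp add: bij_betw_def)
    fix x y assume xy: "x \<in> pverts G" "y \<in> pverts G"
    show "(x, y) \<in> parcs G \<longleftrightarrow> (?f x, ?f y) \<in> parcs H"
    proof
      assume "(?f x, ?f y) \<in> parcs H"
      then obtain a b where ab: "(a, b) \<in> parcs G" "(?f x, ?f y) = iso_arcs h (a, b)"
        using arcsH by auto
      then have "a \<in> pverts G" "b \<in> pverts G" using sub by auto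
      with ab arc inj xy show "(x, y) \<in> parcs G"
        by (metis inj_onD prod.inject)
    qed (use arcsH arc in force)
  qed
qed

lemma isomorphic_disjoint_isolated:
  assumes "isomorphic G H" and "parcs G \<subseteq> pverts G \<times> pverts G" and "parcs H \<subseteq> pverts H \<times> pverts H"
  shows "isomorphic (disjoint_isolated G k) (disjoint_isolated H k)"
proof -
  obtain f where f: "bij_betw f (pverts G) (pverts H)"
    "\<And>x y. x \<in> pverts G \<Longrightarrow> y \<in> pverts G \<Longrightarrow> (x, y) \<in> parcs G \<longleftrightarrow> (f x, f y) \<in> parcs H"
    using isomorphicE[OF assms(1,2)] by blast
  show ?thesis
  proof (rule isomorphicI[where f = "map_sum f id"])
    show "bij_betw (map_sum f id) (pverts (disjoint_isolated G k)) (pverts (disjoint_isolated H k))"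
      using f(1) by (auto simp: bij_betw_def disjoint_isolated_def image_Un image_image intro!: inj_onI dest: inj_onD)
  qed (use assms f(2) in \<open>auto simp: disjoint_isolated_def\<close>)
qed

section \<open>Realising a threshold graph on coordinatewise minima as a competition graph\<close>

lemma strictly_below_imp_sum_less:
  fixes f g :: "real ^ 'n"
  assumes "strictly_below f g"
  shows "(\<Sum>k\<in>UNIV. f $ k) < (\<Sum>k\<in>UNIV. g $ k)"
  using assms by (intro sum_strict_mono) (auto simp: strictly_below_def)

text \<open>
  The speeds \<open>1 + m i\<close> are distinct because \<open>q\<close> need not be injective: different members of the
  family may coincide as sets.
\<close>

lemma eventually_generic_shift:
  fixes q :: "'i \<Rightarrow> real ^ 'n" and m :: "'i \<Rightarrow> nat"
  assumes "finite I" and m: "inj_on m I"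
  defines "v \<equiv> \<lambda>t i. q i + (t * (1 + real (m i))) *\<^sub>R 1"
  shows "eventually (\<lambda>t. inj_on (v t) I) (at_right 0)"
    and "eventually (\<lambda>t. \<forall>i\<in>I. \<forall>j\<in>I. (\<Sum>k\<in>UNIV. min (q i $ k) (q j $ k)) < s \<longrightarrow>
           (\<Sum>k\<in>UNIV. min (v t i $ k) (v t j $ k)) < s) (at_right 0)"
proof -
  have "eventually (\<lambda>t. v t i = v t j \<longrightarrow> i = j) (at_right 0)" if ij: "i \<in> I" "j \<in> I" for i j
  proof (cases "i = j")
    case False
    \<comment> \<open>An arbitrary coordinate suffices, since the shift is the same in all of them.
      There the two points move at different speeds and agree for at most one \<open>t\<close>,
      which a punctured neighbourhood of 0 avoids.\<close>
    let ?k = "undefined :: 'n" and ?e = "real (m j) - real (m i)"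
    have e: "?e \<noteq> 0" using False m ij by (auto dest: inj_onD)
    have "eventually (\<lambda>t. t \<noteq> (q i $ ?k - q j $ ?k) / ?e) (at_right 0)"
      by (rule eventually_neq_at_within)
    then show ?thesis
    proof eventually_elim
      case (elim t)
      show ?case
      proof
        assume "v t i = v t j"
        then have "v t i $ ?k = v t j $ ?k" by simp
        then have "q i $ ?k - q j $ ?k = t * ?e"
          by (simp add: v_def algebra_simps)
        with elim e show "i = j" by simp
      qed
    qed
  qed simp
  then show "eventually (\<lambda>t. inj_on (v t) I) (at_right 0)"
    by (simp add: inj_on_def eventually_ball_finite_distrib assms(1))
  have "eventually (\<lambda>t. (\<Sum>k\<in>UNIV. min (v t i $ k) (v t j $ k)) < s) (at_right 0)"
    if "(\<Sum>k\<in>UNIV. min (q i $ k) (q j $ k)) < s" for i j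
  proof -
    \<comment> \<open>The sum of minima is continuous in \<open>t\<close> and has its unshifted
      value at 0, so a strict inequality survives small shifts.\<close>
    have "((\<lambda>t. \<Sum>k\<in>UNIV. min (v t i $ k) (v t j $ k)) \<longlongrightarrow>
        (\<Sum>k\<in>UNIV. min (v 0 i $ k) (v 0 j $ k))) (at_right 0)"
      unfolding v_def by (intro tendsto_intros)
    with that show ?thesis
      by (intro order_tendstoD(2)) (auto simp: v_def)
  qed
  then show "eventually (\<lambda>t. \<forall>i\<in>I. \<forall>j\<in>I. (\<Sum>k\<in>UNIV. min (q i $ k) (q j $ k)) < s \<longrightarrow>
           (\<Sum>k\<in>UNIV. min (v t i $ k) (v t j $ k)) < s) (at_right 0)"
    using assms(1) by (intro eventually_ball_finite ballI) auto
qed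

text \<open>This is the half of the argument that is free of simplices. The last hypothesis is the
  threshold condition for \<open>i = j\<close>, on which \<open>arcs\<close> is silent; it puts
  every shifted point strictly above the hyperplane of sum \<open>s\<close>.\<close>

lemma competition_realisation:
  fixes q :: "'i \<Rightarrow> real ^ 'n" and H :: "'i pair_pre_digraph"
  assumes fin: "finite (pverts H)"
    and arcs: "parcs H = {(i, j). i \<in> pverts H \<and> j \<in> pverts H \<and> i \<noteq> j \<and>
                 s \<le> (\<Sum>k\<in>UNIV. min (q i $ k) (q j $ k))}"
    and q: "\<And>i. i \<in> pverts H \<Longrightarrow> s \<le> (\<Sum>k\<in>UNIV. q i $ k)"
  shows "\<exists>k S. finite S \<and>
    isomorphic (disjoint_isolated H k) (competition_graph (order_digraph (S :: (real ^ 'n) set)))"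
proof -
  let ?I = "pverts H"
  let ?\<Sigma> = "\<lambda>x :: real ^ 'n. \<Sum>k\<in>UNIV. x $ k"
  obtain m :: "'i \<Rightarrow> nat" where m: "inj_on m ?I"
    using finite_imp_inj_to_nat_seg[OF fin] by blast
  define w where "w t i = q i + (t * (1 + real (m i))) *\<^sub>R 1" for t i
  have "eventually (\<lambda>t. t > 0 \<and> inj_on (w t) ?I \<and>
      (\<forall>i\<in>?I. \<forall>j\<in>?I. (\<Sum>k\<in>UNIV. min (q i $ k) (q j $ k)) < s \<longrightarrow>
           (\<Sum>k\<in>UNIV. min (w t i $ k) (w t j $ k)) < s)) (at_right 0)"
    unfolding w_def
    by (intro eventually_conj eventually_at_right_less eventually_generic_shift fin m)
  from eventually_happens'[OF trivial_limit_at_right_real this]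
  obtain t where t: "t > 0" and inj: "inj_on (w t) ?I"
    \<comment> \<open>Contrapositive of the stability statement: the shift creates no new pair
      reaching the threshold.\<close>
    and sep: "\<And>i j. i \<in> ?I \<Longrightarrow> j \<in> ?I \<Longrightarrow> (\<Sum>k\<in>UNIV. min (w t i $ k) (w t j $ k)) \<ge> s \<Longrightarrow>
        (\<Sum>k\<in>UNIV. min (q i $ k) (q j $ k)) \<ge> s"
    by (meson not_less)
  define v where "v = w t"
  have qv: "q i $ k < v i $ k" for i k
    using t by (simp add: v_def w_def)
  have v_gt: "s < ?\<Sigma> (v i)" if "i \<in> ?I" for i
  proof -
    have "?\<Sigma> (q i) < ?\<Sigma> (v i)"
      by (rule strictly_below_imp_sum_less) (simp add: strictly_below_def qv)
    with q[OF that] show ?thesis by linarith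
  qed
  \<comment> \<open>The coordinatewise minimum, moved along the diagonal into the hyperplane of sum
    \<open>s\<close>. For an arc the move is downwards, because the minimum has sum at least
    \<open>s\<close>.\<close>
  define z :: "'i \<times> 'i \<Rightarrow> real ^ 'n" where "z = (\<lambda>(i, j). \<chi> k. min (q i $ k) (q j $ k) -
      ((\<Sum>k\<in>UNIV. min (q i $ k) (q j $ k)) - s) / real CARD('n))"
  have z_sum: "?\<Sigma> (z (i, j)) = s" for i j
    by (simp add: z_def sum_subtractf)
  have z_below: "strictly_below (z (i, j)) (v i)" "strictly_below (z (i, j)) (v j)"
    if "(i, j) \<in> parcs H" for i j
  proof -
    have "z (i, j) $ k \<le> min (q i $ k) (q j $ k)" for k
    proof -
      have "0 \<le> ((\<Sum>k\<in>UNIV. min (q i $ k) (q j $ k)) - s) / real CARD('n)"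
        using that arcs by simp
      moreover have "z (i, j) $ k = min (q i $ k) (q j $ k) -
          ((\<Sum>k\<in>UNIV. min (q i $ k) (q j $ k)) - s) / real CARD('n)"
        by (simp add: z_def)
      ultimately show ?thesis by linarith
    qed
    then have "z (i, j) $ k < v i $ k" "z (i, j) $ k < v j $ k" for k
      using qv by (meson le_less_trans min.boundedE)+
    then show "strictly_below (z (i, j)) (v i)" "strictly_below (z (i, j)) (v j)"
      by (simp_all add: strictly_below_def)
  qed
  \<comment> \<open>Opposite arcs share their prey, and other arcs may do so as well. Hence the
    number of isolated vertices will be \<open>card Z\<close>, not the number of arcs.\<close>
  define Z where "Z = z ` parcs H"
  have "parcs H \<subseteq> ?I \<times> ?I" using arcs by auto
  then have finZ: "finite Z"
    unfolding Z_def using fin by (meson finite_SigmaI finite_imageI finite_subset)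
  have Z_sum: "?\<Sigma> x = s" if "x \<in> Z" for x
    using that z_sum by (auto simp: Z_def)
  obtain g where g: "bij_betw g {..<card Z} Z"
    using ex_bij_betw_nat_finite[OF finZ] by (auto simp: atLeast0LessThan)
  define S where "S = v ` ?I \<union> Z"
  \<comment> \<open>Every point of \<open>S\<close> has sum at least \<open>s\<close>, so a point
    with something strictly below it has sum above \<open>s\<close> and cannot lie in
    \<open>Z\<close>.\<close>
  have above: "\<exists>i\<in>?I. x = v i" if "x \<in> S" "y \<in> S" "strictly_below y x" for x y
  proof -
    have "s \<le> ?\<Sigma> y"
      using that(2) Z_sum v_gt by (force simp: S_def)
    also have "\<dots> < ?\<Sigma> x" by (rule strictly_below_imp_sum_less[OF that(3)])
    finally show ?thesis
      using that(1) Z_sum by (force simp: S_def)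
  qed
  have arc_iff: "(i, j) \<in> parcs H \<longleftrightarrow>
      v i \<noteq> v j \<and> (\<exists>y\<in>S. strictly_below y (v i) \<and> strictly_below y (v j))"
    if ij: "i \<in> ?I" "j \<in> ?I" for i j
  proof
    assume a: "(i, j) \<in> parcs H"
    then have "v i \<noteq> v j" using arcs inj ij by (auto simp: v_def dest: inj_onD)
    with a z_below[OF a] show "v i \<noteq> v j \<and> (\<exists>y\<in>S. strictly_below y (v i) \<and> strictly_below y (v j))"
      by (auto simp: S_def Z_def)
  next
    assume "v i \<noteq> v j \<and> (\<exists>y\<in>S. strictly_below y (v i) \<and> strictly_below y (v j))"
    then obtain y where y: "y \<in> S" "strictly_below y (v i)" "strictly_below y (v j)" and "i \<noteq> j"
      by auto
    have "s \<le> ?\<Sigma> y"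
      using y(1) Z_sum v_gt by (force simp: S_def)
    also have "\<dots> \<le> (\<Sum>k\<in>UNIV. min (v i $ k) (v j $ k))"
      using y(2,3) by (intro sum_mono) (simp add: strictly_below_def less_imp_le)
    finally show "(i, j) \<in> parcs H"
      using sep[OF ij] ij \<open>i \<noteq> j\<close> arcs by (simp add: v_def)
  qed
  define f where "f = case_sum v g"
  have "isomorphic (disjoint_isolated H (card Z)) (competition_graph (order_digraph S))"
  proof (rule isomorphicI[where f = f])
    \<comment> \<open>Coordinate sums separate the two kinds of points, so \<open>v\<close> and
      \<open>g\<close> glue to one bijection.\<close>
    have "v ` ?I \<inter> Z = {}" using v_gt Z_sum by force
    moreover have "inj_on v ?I" using inj by (simp add: v_def)
    moreover have "bij_betw f (Inr ` {..<card Z}) Z"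
      using g by (simp add: f_def bij_betw_def image_image inj_on_def)
    ultimately have "bij_betw f (Inl ` ?I \<union> Inr ` {..<card Z}) (v ` ?I \<union> Z)"
      by (intro bij_betw_combine) (simp_all add: f_def bij_betw_def image_image inj_on_def)
    then show "bij_betw f (pverts (disjoint_isolated H (card Z)))
        (pverts (competition_graph (order_digraph S)))"
      by (simp add: disjoint_isolated_def competition_graph_def order_digraph_def S_def)
  next
    fix a b
    assume ab: "a \<in> pverts (disjoint_isolated H (card Z))" "b \<in> pverts (disjoint_isolated H (card Z))"
    have Zno: "\<not> strictly_below y x" if "x \<in> Z" "y \<in> S" for x y
      using above[of x y] that v_gt Z_sum by (force simp: S_def)
    have gZ: "g n \<in> Z" if "n < card Z" for n
      using g that by (auto simp: bij_betw_def)
    have comp: "(x, y) \<in> parcs (competition_graph (order_digraph S)) \<longleftrightarrow>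
        x \<in> S \<and> y \<in> S \<and> x \<noteq> y \<and> (\<exists>z\<in>S. strictly_below z x \<and> strictly_below z y)" for x y
      by (auto simp: competition_graph_def order_digraph_def)
    have isol: "(a, b) \<in> parcs (disjoint_isolated H (card Z)) \<longleftrightarrow>
        (\<exists>i j. a = Inl i \<and> b = Inl j \<and> (i, j) \<in> parcs H)"
      by (auto simp: disjoint_isolated_def)
    consider (Inl) i j where "a = Inl i" "b = Inl j" "i \<in> ?I" "j \<in> ?I"
      | (Inr) n where "a = Inr n \<or> b = Inr n" "n < card Z"
      using ab by (auto simp: disjoint_isolated_def)
    then show "(a, b) \<in> parcs (disjoint_isolated H (card Z)) \<longleftrightarrow>
        (f a, f b) \<in> parcs (competition_graph (order_digraph S))"
    proof cases
      case Inl
      then have "v i \<in> S" "v j \<in> S" by (simp_all add: S_def)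
      with Inl arc_iff[of i j] show ?thesis
        unfolding isol comp by (simp add: f_def)
    next
      case Inr
      then have "f a \<in> Z \<or> f b \<in> Z" using gZ by (auto simp: f_def)
      then have "(f a, f b) \<notin> parcs (competition_graph (order_digraph S))"
        using Zno unfolding comp by blast
      with Inr show ?thesis unfolding isol by blast
    qed
  qed (use arcs in \<open>auto simp: disjoint_isolated_def competition_graph_def order_digraph_def\<close>)
  moreover have "finite S" using fin finZ by (simp add: S_def)
  ultimately show ?thesis by blast
qed

section \<open>Simplices in barycentric coordinates\<close>

text \<open>\<open>\<phi>\<close> sends the unit vectors to the vertices. Affine independence makes
  it injective on the hyperplane of sum 1, and the number of vertices makes it surjective. It is
  linear on the whole of \<open>real ^ 'n\<close>, so that homotheties can be lifted.\<close>

lemma simplex_barycentric: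
  fixes A :: "(real ^ 'm) set"
  assumes A: "int CARD('m) simplex A" and card: "CARD('n) = CARD('m) + 1"
  obtains \<phi> :: "real ^ 'n \<Rightarrow> real ^ 'm"
  where "linear \<phi>" and "bij_betw \<phi> {w. (\<Sum>k\<in>UNIV. w $ k) = 1} UNIV"
    and "A = \<phi> ` {w. (\<Sum>k\<in>UNIV. w $ k) = 1 \<and> (\<forall>k. 0 \<le> w $ k)}"
proof -
  obtain C where C: "finite C" "\<not> affine_dependent C" "card C = CARD('m) + 1" "A = convex hull C"
    using A unfolding simplex by (metis of_nat_1 of_nat_add of_nat_eq_iff)
  obtain e :: "'n \<Rightarrow> real ^ 'm" where e: "bij_betw e UNIV C"
    using C(1,3) card finite_same_card_bij[of "UNIV :: 'n set" C] by auto
  define \<phi> :: "real ^ 'n \<Rightarrow> real ^ 'm" where "\<phi> w = (\<Sum>k\<in>UNIV. w $ k *\<^sub>R e k)" for w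
  have C_sum: "(\<Sum>c\<in>C. h c) = (\<Sum>k\<in>UNIV. h (e k))" for h :: "real ^ 'm \<Rightarrow> 'b::comm_monoid_add"
    using sum.reindex_bij_betw[OF e, of h] by simp
  \<comment> \<open>Translates weight functions on \<open>C\<close>, in which the library describes
    hulls, into coordinate vectors; \<open>vec_inv\<close> goes back.\<close>
  define vec :: "(real ^ 'm \<Rightarrow> real) \<Rightarrow> real ^ 'n" where "vec u = (\<chi> k. u (e k))" for u
  have vec: "(\<Sum>k\<in>UNIV. vec u $ k) = sum u C" "\<phi> (vec u) = (\<Sum>c\<in>C. u c *\<^sub>R c)" for u
    by (simp_all add: vec_def \<phi>_def C_sum)
  have lin: "linear \<phi>"
    by (intro linearI) (simp_all add: \<phi>_def sum.distrib scaleR_left_distrib scaleR_sum_right)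
  have inv_e: "the_inv e (e k) = k" for k
    using e by (simp add: bij_betw_def the_inv_f_f)
  have vec_inv: "vec (\<lambda>c. w $ the_inv e c) = w" for w
    by (simp add: vec_def inv_e vec_eq_iff)
  show thesis
  proof
    show "linear \<phi>" by (rule lin)
    have "affine hull C = UNIV"
      by (intro affine_independent_span_gt[OF C(2)]) (simp add: C(3))
    then have "\<exists>u. sum u C = 1 \<and> (\<Sum>c\<in>C. u c *\<^sub>R c) = x" for x
      unfolding affine_hull_finite[OF C(1)] by blast
    then have "\<exists>w. (\<Sum>k\<in>UNIV. w $ k) = 1 \<and> x = \<phi> w" for x
      by (metis vec)
    then have "\<phi> ` {w. (\<Sum>k\<in>UNIV. w $ k) = 1} = UNIV"
      by (intro equalityI subset_UNIV subsetI) blast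
    moreover have "inj_on \<phi> {w. (\<Sum>k\<in>UNIV. w $ k) = 1}"
    proof (rule inj_onI)
      fix x y assume x: "x \<in> {w. (\<Sum>k\<in>UNIV. w $ k) = 1}" and y: "y \<in> {w. (\<Sum>k\<in>UNIV. w $ k) = 1}"
        and eq: "\<phi> x = \<phi> y"
      \<comment> \<open>The difference of two preimages gives weights of sum 0 whose combination
        vanishes, so affine independence forces them to be 0 on \<open>C\<close>.\<close>
      define u where "u c = (x - y) $ the_inv e c" for c
      have xy: "vec u = x - y" unfolding u_def by (rule vec_inv)
      have "sum u C = 0" "(\<Sum>c\<in>C. u c *\<^sub>R c) = 0"
        using x y eq by (simp_all flip: vec add: xy sum_subtractf linear_diff[OF lin])
      then have "\<forall>c\<in>C. u c = 0"
        using C(2) affine_dependent_explicit_finite[OF C(1)] by blast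
      then have "vec u = 0"
        using e by (simp add: vec_def vec_eq_iff bij_betw_apply)
      with xy show "x = y" by simp
    qed
    ultimately show "bij_betw \<phi> {w. (\<Sum>k\<in>UNIV. w $ k) = 1} UNIV"
      by (simp add: bij_betw_def)
    show "A = \<phi> ` {w. (\<Sum>k\<in>UNIV. w $ k) = 1 \<and> (\<forall>k. 0 \<le> w $ k)}" (is "_ = _ ` ?W")
    proof (intro equalityI subsetI)
      fix x assume "x \<in> A"
      then obtain u where u: "\<forall>c\<in>C. 0 \<le> u c" "sum u C = 1" "(\<Sum>c\<in>C. u c *\<^sub>R c) = x"
        unfolding C(4) convex_hull_finite[OF C(1)] by blast
      have "0 \<le> vec u $ k" for k
        using u(1) bij_betw_apply[OF e] by (simp add: vec_def)
      with u vec[of u] have "vec u \<in> ?W" "x = \<phi> (vec u)" by simp_all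
      then show "x \<in> \<phi> ` ?W" by blast
    next
      fix x assume "x \<in> \<phi> ` ?W"
      then obtain w where w: "w \<in> ?W" "x = \<phi> w" by blast
      define u where "u c = w $ the_inv e c" for c
      have "vec u = w" unfolding u_def by (rule vec_inv)
      then have "sum u C = 1" "(\<Sum>c\<in>C. u c *\<^sub>R c) = x"
        using w vec[of u] by simp_all
      moreover have "\<forall>c\<in>C. 0 \<le> u c"
        using w by (simp add: u_def)
      ultimately show "x \<in> A"
        unfolding C(4) convex_hull_finite[OF C(1)] by blast
    qed
  qed
qed

text \<open>The homothety with ratio \<open>c\<close> and translation \<open>b\<close> lifts to
  \<open>c *\<^sub>R w + p\<close> with \<open>\<phi> p = b\<close>. If \<open>p\<close> has sum
  \<open>1 - c\<close>, this map preserves the hyperplane and moves the corner of the orthant from 0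
  to \<open>p\<close>.\<close>

lemma homothetic_barycentric:
  fixes \<phi> :: "real ^ 'n \<Rightarrow> 'a::real_vector"
  assumes lin: "linear \<phi>" and surj: "\<phi> ` {w. (\<Sum>k\<in>UNIV. w $ k) = 1} = UNIV"
    and A: "A = \<phi> ` {w. (\<Sum>k\<in>UNIV. w $ k) = 1 \<and> (\<forall>k. 0 \<le> w $ k)}"
    and "homothetic A B"
  shows "\<exists>p. B = \<phi> ` {w. (\<Sum>k\<in>UNIV. w $ k) = 1 \<and> (\<forall>k. p $ k \<le> w $ k)}"
proof -
  obtain c b where c: "c > 0" and B: "B = (\<lambda>x. c *\<^sub>R x + b) ` A"
    using assms(4) by (auto simp: homothetic_def)
  let ?e = "axis undefined 1 :: real ^ 'n"
  \<comment> \<open>Surjectivity is known only on the hyperplane of sum 1. Lifting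
    \<open>b + c *\<^sub>R \<phi> ?e\<close> there and subtracting \<open>c *\<^sub>R ?e\<close>
    gives a preimage of \<open>b\<close> with the desired sum \<open>1 - c\<close>.\<close>
  obtain r where r: "(\<Sum>k\<in>UNIV. r $ k) = 1" "\<phi> r = b + c *\<^sub>R \<phi> ?e"
    using surj by (metis (mono_tags, lifting) UNIV_I imageE mem_Collect_eq)
  define p where "p = r - c *\<^sub>R ?e"
  have p: "\<phi> p = b"
    by (simp add: p_def r linear_diff[OF lin] linear_scale[OF lin])
  have p_sum: "(\<Sum>k\<in>UNIV. p $ k) = 1 - c"
    by (simp add: p_def r sum_subtractf axis_def flip: sum_distrib_left)
  let ?f = "\<lambda>w. c *\<^sub>R w + p"
  have "?f ` {w. (\<Sum>k\<in>UNIV. w $ k) = 1 \<and> (\<forall>k. 0 \<le> w $ k)}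
      = {w. (\<Sum>k\<in>UNIV. w $ k) = 1 \<and> (\<forall>k. p $ k \<le> w $ k)}" (is "_ = ?R")
  proof (intro equalityI subsetI)
    fix w assume w: "w \<in> ?R"
    have "w = ?f ((w - p) /\<^sub>R c)" using c by simp
    moreover have "(\<Sum>k\<in>UNIV. ((w - p) /\<^sub>R c) $ k) = 1"
      using w c p_sum by (simp add: sum_subtractf flip: sum_distrib_left)
    ultimately show "w \<in> ?f ` {w. (\<Sum>k\<in>UNIV. w $ k) = 1 \<and> (\<forall>k. 0 \<le> w $ k)}"
      using w c by (intro image_eqI[where x = "(w - p) /\<^sub>R c"]) auto
  qed (use c p_sum in \<open>auto simp: sum.distrib simp flip: sum_distrib_left\<close>)
  moreover have "B = \<phi> ` ?f ` {w. (\<Sum>k\<in>UNIV. w $ k) = 1 \<and> (\<forall>k. 0 \<le> w $ k)}"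
    by (simp add: B A image_image p linear_add[OF lin] linear_scale[OF lin])
  ultimately show ?thesis by auto
qed

text \<open>A common point dominates the maximum of the two corners, so that maximum has sum at most
  1. Negation turns this into the condition on minima that the competition graph uses.\<close>

lemma orthants_meet_hyperplane_iff:
  fixes p p' :: "real ^ 'n"
  shows "{w. (\<Sum>k\<in>UNIV. w $ k) = 1 \<and> (\<forall>k. p $ k \<le> w $ k)} \<inter>
         {w. (\<Sum>k\<in>UNIV. w $ k) = 1 \<and> (\<forall>k. p' $ k \<le> w $ k)} \<noteq> {} \<longleftrightarrow>
         -1 \<le> (\<Sum>k\<in>UNIV. min ((- p) $ k) ((- p') $ k))" (is "?L \<longleftrightarrow> ?R")
proof -
  let ?m = "\<lambda>k. max (p $ k) (p' $ k)"
  have eq: "(\<Sum>k\<in>UNIV. min ((- p) $ k) ((- p') $ k)) = - (\<Sum>k\<in>UNIV. ?m k)"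
    by (simp add: minus_max_eq_min flip: sum_negf)
  show ?thesis
  proof
    assume ?L
    then obtain w where w: "(\<Sum>k\<in>UNIV. w $ k) = 1" "\<And>k. p $ k \<le> w $ k" "\<And>k. p' $ k \<le> w $ k"
      by blast
    then have "(\<Sum>k\<in>UNIV. ?m k) \<le> (\<Sum>k\<in>UNIV. w $ k)"
      by (intro sum_mono) simp
    with w(1) eq show ?R by linarith
  next
    assume ?R
    \<comment> \<open>The maximum of the corners, with the slack up to sum 1 spread evenly over the
      coordinates.\<close>
    define w :: "real ^ 'n" where "w = (\<chi> k. ?m k + (1 - (\<Sum>k\<in>UNIV. ?m k)) / real CARD('n))"
    have "0 \<le> (1 - (\<Sum>k\<in>UNIV. ?m k)) / real CARD('n)"
      using \<open>?R\<close> eq by simp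
    then have "?m k \<le> w $ k" for k by (simp add: w_def)
    moreover have "(\<Sum>k\<in>UNIV. w $ k) = 1"
      by (simp add: w_def sum.distrib)
    ultimately show ?L by fastforce
  qed
qed

theorem theorem2p12:
  fixes d :: nat
    and G :: "'v pair_pre_digraph"
    and I :: "'i set"
    and T :: "'i \<Rightarrow> (real ^ 'm) set"
  assumes "2 \<le> d"
    and "CARD('n::finite) = d"
    and "CARD('m::finite) = d - 1"
    and "pair_graph G"
    and "finite I"
    and "\<forall>i\<in>I. regular_simplex (d - 1) (T i)"
    and "\<forall>i\<in>I. \<forall>j\<in>I. homothetic (T i) (T j)"
    and "isomorphic G (intersection_graph I T)"
  shows "\<exists>k. \<exists>D :: (real ^ 'n) pair_pre_digraph.
           partial_order_digraph TYPE('n) D \<and>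
           isomorphic (disjoint_isolated G k) (competition_graph D)"
proof -
  let ?H = "intersection_graph I T"
  have "\<exists>q :: 'i \<Rightarrow> real ^ 'n. \<forall>i\<in>I. \<forall>j\<in>I.
      T i \<inter> T j \<noteq> {} \<longleftrightarrow> -1 \<le> (\<Sum>k\<in>UNIV. min (q i $ k) (q j $ k))"
  proof (cases "I = {}")
    case False
    \<comment> \<open>Any member serves as the reference simplex, and all members, itself included,
      are homothetic to it.\<close>
    then obtain i0 where i0: "i0 \<in> I" by blast
    have "int CARD('m) simplex T i0" "CARD('n) = CARD('m) + 1"
      using assms i0 by (auto simp: regular_simplex_def)
    then obtain \<phi> :: "real ^ 'n \<Rightarrow> real ^ 'm" where lin: "linear \<phi>"
      and bij: "bij_betw \<phi> {w. (\<Sum>k\<in>UNIV. w $ k) = 1} UNIV"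
      and T0: "T i0 = \<phi> ` {w. (\<Sum>k\<in>UNIV. w $ k) = 1 \<and> (\<forall>k. 0 \<le> w $ k)}"
      by (rule simplex_barycentric)
    have inj: "inj_on \<phi> {w. (\<Sum>k\<in>UNIV. w $ k) = 1}"
      and surj: "\<phi> ` {w. (\<Sum>k\<in>UNIV. w $ k) = 1} = UNIV"
      using bij by (auto simp: bij_betw_def)
    define W where "W p = {w :: real ^ 'n. (\<Sum>k\<in>UNIV. w $ k) = 1 \<and> (\<forall>k. p $ k \<le> w $ k)}" for p
    have "\<forall>i\<in>I. \<exists>p. T i = \<phi> ` W p"
      using homothetic_barycentric[OF lin surj T0] assms(7) i0 unfolding W_def by blast
    then obtain p where p: "\<And>i. i \<in> I \<Longrightarrow> T i = \<phi> ` W (p i)"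
      by metis
    have "T i \<inter> T j \<noteq> {} \<longleftrightarrow> -1 \<le> (\<Sum>k\<in>UNIV. min ((- p i) $ k) ((- p j) $ k))"
      if "i \<in> I" "j \<in> I" for i j
    proof -
      \<comment> \<open>Both \<open>W (p i)\<close> and \<open>W (p j)\<close> lie in the hyperplane
        on which \<open>\<phi>\<close> is injective, so taking images commutes with
        intersecting.\<close>
      have "T i \<inter> T j = \<phi> ` (W (p i) \<inter> W (p j))"
        using that p by (subst inj_on_image_Int[OF inj]) (auto simp: W_def)
      then show ?thesis
        using orthants_meet_hyperplane_iff[of "p i" "p j"] by (simp add: W_def)
    qed
    then show ?thesis by (intro exI[of _ "\<lambda>i. - p i"]) blast
  qed simp
  then obtain q :: "'i \<Rightarrow> real ^ 'n" where q: "\<And>i j. i \<in> I \<Longrightarrow> j \<in> I \<Longrightarrow>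
      T i \<inter> T j \<noteq> {} \<longleftrightarrow> -1 \<le> (\<Sum>k\<in>UNIV. min (q i $ k) (q j $ k))"
    by blast
  \<comment> \<open>Needed for the case \<open>i = j\<close> of \<open>q\<close>: the empty set is a
    simplex of dimension -1 only.\<close>
  have nonempty: "T i \<noteq> {}" if "i \<in> I" for i
    using assms(6) that by (auto simp: regular_simplex_def)
  have q_self: "-1 \<le> (\<Sum>k\<in>UNIV. q i $ k)" if "i \<in> I" for i
    using q[of i i] nonempty that by simp
  have "\<exists>k S. finite S \<and>
      isomorphic (disjoint_isolated ?H k) (competition_graph (order_digraph (S :: (real ^ 'n) set)))"
    using assms(5) q q_self
    by (intro competition_realisation[where s = "-1" and q = q]) (auto simp: intersection_graph_def)
  then obtain k and S :: "(real ^ 'n) set" where "finite S"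
    and iso: "isomorphic (disjoint_isolated ?H k) (competition_graph (order_digraph S))"
    by blast
  have "isomorphic (order_digraph S) (order_digraph S)"
    by (rule isomorphicI[where f = id]) (auto simp: order_digraph_def)
  with \<open>finite S\<close> have "partial_order_digraph TYPE('n) (order_digraph S)"
    unfolding partial_order_digraph_def by blast
  moreover have "isomorphic (disjoint_isolated G k) (disjoint_isolated ?H k)"
  proof (rule isomorphic_disjoint_isolated[OF assms(8)])
    interpret pair_graph G by fact
    show "parcs G \<subseteq> pverts G \<times> pverts G" using wellformed' by auto
  qed (auto simp: intersection_graph_def)
  ultimately show ?thesis using iso digraph_iso_trans by blast
qed

end
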